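(* Let $(X,\rho,W)$ be a hyperbolic space, $(M,d)$ a metric space with the AFPP for nonexpansive mappings, and $(C_u)_{u\in M}$ a family of nonempty convex subsets of $X$ for which there is a nonexpansive function $\delta:M\to\bigcup_{u\in M}C_u$ with $\delta(u)\in C_u$ for all $u\in M$; fix such a $\delta$. Let $H:=\{(x,u): u\in M,\ x\in C_u\}$, regarded as a subspace of $(X\times M)_\infty$, and let $T:H\to H$ be a nonexpansive function such that $(P_1\circ T)(x,u)\in C_u$ for all $(x,u)\in H$. For $u\in M$ let $T_u:C_u\to C_u$, $T_u(x)=(P_1\circ T)(x,u)$. Let $(\lambda_n)_{n\in\mathbb{N}}$ be a sequence in $[0,1)$, and let $K\in\mathbb{N}$, $\alpha:\mathbb{N}\to\mathbb{N}$ be such that for all $n\in\mathbb{N}$, $\lambda_n\le1-\frac1K$ and $n\le\sum_{i=0}^{\alpha(n)}\lambda_i$. Assume that there is $b>0$ such that $$\forall u\in M\ \exists y\in C_u\ \Big(\rho(\delta(u),y)\le b\ \wedge\ \forall m,p\in\mathbb{N}\ \big(\rho(y^u_m,y^u_p)\le b\big)\Big),$$ where $(y_n^u)_{n\in\mathbb{N}}$ is the Krasnoselski-Mann iteration starting from $y$ associated with $T_u$ (and $(\lambda_n)$). Then $r_H(T)=0$.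
   Context: A hyperbolic space is a triple $(X,\rho,W)$ where $(X,\rho)$ is a metric space and $W:X\times X\times[0,1]\to X$ satisfies, for all $x,y,z,w\in X$ and $\lambda,\tilde\lambda\in[0,1]$: (W1) $\rho(z,W(x,y,\lambda))\le(1-\lambda)\rho(z,x)+\lambda\rho(z,y)$; (W2) $\rho(W(x,y,\lambda),W(x,y,\tilde\lambda))=|\lambda-\tilde\lambda|\,\rho(x,y)$; (W3) $W(x,y,\lambda)=W(y,x,1-\lambda)$; (W4) $\rho(W(x,z,\lambda),W(y,w,\lambda))\le(1-\lambda)\rho(x,y)+\lambda\rho(z,w)$. Write $(1-\lambda)x\oplus\lambda y$ for $W(x,y,\lambda)$. A subset $C\subseteq X$ is convex if $W(x,y,\lambda)\in C$ for all $x,y\in C$, $\lambda\in[0,1]$. A map $T$ between metric spaces is nonexpansive if it does not increase distances (1-Lipschitz). For a self-map $T:Y\to Y$ of a metric space $(Y,\rho)$, $r_Y(T):=\inf\{\rho(y,T(y)) : y\in Y\}$. A metric space $Y$ has the approximate fixed point property (AFPP) for nonexpansive mappings if every nonexpansive $T:Y\to Y$ admits a sequence $(u_n)$ in $Y$ with $\rho(u_n,T(u_n))\to0$ (equivalently $r_Y(T)=0$). $(X\times M)_\infty$ is the set $X\times M$ with the metric $d_\infty((x,u),(y,v))=\max\{\rho(x,y),d(u,v)\}$. $P_1:H\to\bigcup_{u\in M}C_u$ is the projection $(x,u)\mapsto x$. Each $T_u$ is nonexpansive. The Krasnoselski-Mann iteration starting from $y\in C_u$ associated with $T_u$ is $y_0^u:=y$,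 $y^u_{n+1}:=(1-\lambda_n)y^u_n\oplus\lambda_nT_u(y^u_n)$. *)

theory Defs
  imports "HOL-Analysis.Analysis"
begin

text \<open>Metric spaces are carrier-based (library locale \<^locale>\<open>Metric_space\<close>), so that
  subspaces and spaces of arbitrary carrier are treated uniformly.
  The term \<open>W x y l\<close> stands for \<open>(1 - l) x \<oplus> l y\<close>.\<close>

locale hyperbolic_space = Metric_space X \<rho>
  for X :: "'a set" and \<rho> :: "'a \<Rightarrow> 'a \<Rightarrow> real" +
  fixes W :: "'a \<Rightarrow> 'a \<Rightarrow> real \<Rightarrow> 'a"
  assumes W_closed: "\<lbrakk>x \<in> X; y \<in> X; l \<in> {0..1}\<rbrakk> \<Longrightarrow> W x y l \<in> X"
    and W1: "\<lbrakk>x \<in> X; y \<in> X; z \<in> X; l \<in> {0..1}\<rbrakk>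
      \<Longrightarrow> \<rho> z (W x y l) \<le> (1 - l) * \<rho> z x + l * \<rho> z y"
    and W2: "\<lbrakk>x \<in> X; y \<in> X; l \<in> {0..1}; l' \<in> {0..1}\<rbrakk>
      \<Longrightarrow> \<rho> (W x y l) (W x y l') = \<bar>l - l'\<bar> * \<rho> x y"
    and W3: "\<lbrakk>x \<in> X; y \<in> X; l \<in> {0..1}\<rbrakk> \<Longrightarrow> W x y l = W y x (1 - l)"
    and W4: "\<lbrakk>x \<in> X; y \<in> X; z \<in> X; w \<in> X; l \<in> {0..1}\<rbrakk>
      \<Longrightarrow> \<rho> (W x z l) (W y w l) \<le> (1 - l) * \<rho> x y + l * \<rho> z w"

definition W_convex :: "('a \<Rightarrow> 'a \<Rightarrow> real \<Rightarrow> 'a) \<Rightarrow> 'a set \<Rightarrow> bool" where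
  "W_convex W C \<longleftrightarrow> (\<forall>x\<in>C. \<forall>y\<in>C. \<forall>l\<in>{0..1}. W x y l \<in> C)"

definition nonexpansive ::
  "'a set \<Rightarrow> ('a \<Rightarrow> 'a \<Rightarrow> real) \<Rightarrow> 'b set \<Rightarrow> ('b \<Rightarrow> 'b \<Rightarrow> real) \<Rightarrow> ('a \<Rightarrow> 'b) \<Rightarrow> bool" where
  "nonexpansive Y d Z e f \<longleftrightarrow>
     f \<in> Y \<rightarrow> Z \<and> (\<forall>x\<in>Y. \<forall>y\<in>Y. e (f x) (f y) \<le> d x y)"

text \<open>The number \<open>r\<^sub>Y(T)\<close>. The infimum is meaningful for nonempty \<open>Y\<close> only;
  on the empty set \<^const>\<open>Inf\<close> on the reals is unspecified.\<close>

definition min_displacement :: "'a set \<Rightarrow> ('a \<Rightarrow> 'a \<Rightarrow> real) \<Rightarrow> ('a \<Rightarrow> 'a) \<Rightarrow> real" where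
  "min_displacement Y d T = (INF y\<in>Y. d y (T y))"

text \<open>The empty space does not have this property, as it contains no sequences.\<close>

definition AFPP :: "'a set \<Rightarrow> ('a \<Rightarrow> 'a \<Rightarrow> real) \<Rightarrow> bool" where
  "AFPP Y d \<longleftrightarrow>
     (\<forall>T. nonexpansive Y d Y d T \<longrightarrow>
        (\<exists>u :: nat \<Rightarrow> 'a. (\<forall>n. u n \<in> Y) \<and> (\<lambda>n. d (u n) (T (u n))) \<longlonglongrightarrow> 0))"

definition dist_max ::
  "('a \<Rightarrow> 'a \<Rightarrow> real) \<Rightarrow> ('b \<Rightarrow> 'b \<Rightarrow> real) \<Rightarrow> 'a \<times> 'b \<Rightarrow> 'a \<times> 'b \<Rightarrow> real" where
  "dist_max \<rho> d p q = max (\<rho> (fst p) (fst q)) (d (snd p) (snd q))"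

lemma Metric_space_dist_max:
  assumes "Metric_space X \<rho>" and "Metric_space M d"
  shows "Metric_space (X \<times> M) (dist_max \<rho> d)"
proof -
  interpret X: Metric_space X \<rho> by fact
  interpret M: Metric_space M d by fact
  show ?thesis
  proof
    fix p q :: "'a \<times> 'b"
    show "0 \<le> dist_max \<rho> d p q"
      by (simp add: dist_max_def le_max_iff_disj)
    show "dist_max \<rho> d p q = dist_max \<rho> d q p"
      by (simp add: dist_max_def X.commute M.commute)
  next
    fix p q assume "p \<in> X \<times> M" "q \<in> X \<times> M"
    then have "\<rho> (fst p) (fst q) = 0 \<longleftrightarrow> fst p = fst q" "d (snd p) (snd q) = 0 \<longleftrightarrow> snd p = snd q"
      by (auto simp: mem_Times_iff)
    moreover have "0 \<le> \<rho> (fst p) (fst q)" "0 \<le> d (snd p) (snd q)"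
      by simp_all
    ultimately show "(dist_max \<rho> d p q = 0) = (p = q)"
      unfolding dist_max_def prod_eq_iff by linarith
  next
    fix p q r assume "p \<in> X \<times> M" "q \<in> X \<times> M" "r \<in> X \<times> M"
    then show "dist_max \<rho> d p r \<le> dist_max \<rho> d p q + dist_max \<rho> d q r"
      using X.triangle[of "fst p" "fst q" "fst r"] M.triangle[of "snd p" "snd q" "snd r"]
      by (auto simp: dist_max_def mem_Times_iff)
  qed
qed

primrec KM_iteration ::
  "('a \<Rightarrow> 'a \<Rightarrow> real \<Rightarrow> 'a) \<Rightarrow> (nat \<Rightarrow> real) \<Rightarrow> ('a \<Rightarrow> 'a) \<Rightarrow> 'a \<Rightarrow> nat \<Rightarrow> 'a" where
  "KM_iteration W l S y 0 = y"
| "KM_iteration W l S y (Suc n) =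
     W (KM_iteration W l S y n) (S (KM_iteration W l S y n)) (l n)"

end

theory Submission
  imports Defs
begin

text \<open>For fixed \<open>n\<close>, let \<open>z u\<close> be the \<open>n\<close>-th Krasnoselski-Mann iterate of \<open>T\<^sub>u\<close> started at
  \<open>\<delta> u\<close>. By induction on \<open>n\<close>, \<open>z\<close> is nonexpansive in \<open>u\<close>, hence so is the self-map
  \<open>u \<mapsto> snd (T (z u, u))\<close> of \<open>M\<close>, and the AFPP yields \<open>u\<close> almost fixed by it. It remains to choose
  \<open>n\<close> such that \<open>\<rho> (z u) (T\<^sub>u (z u))\<close> is small uniformly in \<open>u\<close>. The iterations from \<open>\<delta> u\<close> and
  from the given \<open>y\<close> stay within distance \<open>b\<close>, so the former have diameter at most \<open>3 b\<close>, and the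
  Goebel-Kirk inequality gives a rate of asymptotic regularity depending only on \<open>b\<close> and the
  \<open>\<lambda>\<^sub>n\<close>.\<close>

section \<open>Krasnoselski-Mann iterations: invariance and comparison\<close>

lemma KM_iteration_in:
  assumes "W_convex W C" "S \<in> C \<rightarrow> C" "y \<in> C" "\<And>n. l n \<in> {0..<1}"
  shows "KM_iteration W l S y n \<in> C"
proof (induction n)
  case 0
  then show ?case using assms by simp
next
  case (Suc n)
  have "l n \<in> {0..1}" using assms(4)[of n] by auto
  then show ?case using Suc assms(1,2) by (auto simp: W_convex_def Pi_iff)
qed

text \<open>The number \<open>D\<close> is \<open>\<rho> y z\<close> for two starting points and the same map, and \<open>d u v\<close> for the
  maps \<open>T\<^sub>u\<close> and \<open>T\<^sub>v\<close>.\<close>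

lemma (in hyperbolic_space) KM_iteration_close:
  assumes "A \<subseteq> X" "W_convex W A" "S \<in> A \<rightarrow> A" "y \<in> A"
    and "B \<subseteq> X" "W_convex W B" "S' \<in> B \<rightarrow> B" "z \<in> B"
    and l: "\<And>n. l n \<in> {0..<1}"
    and S: "\<And>x x'. x \<in> A \<Longrightarrow> x' \<in> B \<Longrightarrow> \<rho> x x' \<le> D \<Longrightarrow> \<rho> (S x) (S' x') \<le> D"
    and "\<rho> y z \<le> D"
  shows "\<rho> (KM_iteration W l S y n) (KM_iteration W l S' z n) \<le> D"
proof (induction n)
  case 0
  then show ?case using assms by simp
next
  case (Suc n)
  let ?x = "KM_iteration W l S y n" and ?x' = "KM_iteration W l S' z n"
  have x: "?x \<in> A" "?x' \<in> B"
    using assms by (auto intro!: KM_iteration_in)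
  then have Sx: "S ?x \<in> A" "S' ?x' \<in> B"
    using assms by auto
  have ln: "l n \<in> {0..1}" using l[of n] by auto
  have "\<rho> (W ?x (S ?x) (l n)) (W ?x' (S' ?x') (l n))
      \<le> (1 - l n) * \<rho> ?x ?x' + l n * \<rho> (S ?x) (S' ?x')"
    using W4 x Sx ln \<open>A \<subseteq> X\<close> \<open>B \<subseteq> X\<close> by blast
  also have "\<dots> \<le> (1 - l n) * D + l n * D"
    using Suc S[OF x Suc] ln by (intro add_mono mult_left_mono) auto
  finally show ?case by (simp add: algebra_simps)
qed

section \<open>Residuals along a single iteration\<close>

context hyperbolic_space
begin

context
  fixes A :: "'a set" and S :: "'a \<Rightarrow> 'a" and l :: "nat \<Rightarrow> real" and y :: 'a
  assumes A: "A \<subseteq> X" "W_convex W A"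
    and S: "nonexpansive A \<rho> A \<rho> S"
    and l: "\<And>n. l n \<in> {0..<1}"
    and y: "y \<in> A"
begin

private abbreviation (input) "x \<equiv> KM_iteration W l S y"
private abbreviation (input) "r n \<equiv> \<rho> (x n) (S (x n))"

lemma KM_in: "x n \<in> X" "S (x n) \<in> X" "x n \<in> A" "l n \<in> {0..1}"
proof -
  show "x n \<in> A"
    using A S l y by (intro KM_iteration_in) (auto simp: nonexpansive_def)
  then show "x n \<in> X" "S (x n) \<in> X"
    using A S by (auto simp: nonexpansive_def)
  show "l n \<in> {0..1}" using l[of n] by auto
qed

lemma KM_step: "\<rho> (x n) (x (Suc n)) = l n * r n"
proof -
  \<comment> \<open>\<open>W1\<close> with \<open>z\<close> equal to the first endpoint gives
    \<open>W x y 0 = x\<close>, so \<open>W2\<close> with parameters \<open>0\<close> and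
    \<open>l n\<close> measures the step.\<close>
  have "\<rho> (x n) (W (x n) (S (x n)) 0) \<le> 0"
    using W1[of "x n" "S (x n)" "x n" 0] KM_in[of n] by simp
  moreover have "\<rho> (W (x n) (S (x n)) 0) (x (Suc n)) = l n * r n"
    using W2[of "x n" "S (x n)" 0 "l n"] KM_in[of n] by simp
  moreover have "W (x n) (S (x n)) 0 \<in> X"
    using KM_in[of n] by (intro W_closed) auto
  ultimately show ?thesis
    using KM_in(1,2)[of n] zero nonneg[of "x n"] by (metis order_antisym)
qed

lemma KM_step_image: "\<rho> (S (x n)) (S (x (Suc n))) \<le> l n * r n"
  using S KM_in(3)[of n] KM_in(3)[of "Suc n"] KM_step[of n]
  unfolding nonexpansive_def by metis

text \<open>Pass through \<open>S (x n)\<close>: the convex step leaves the share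
  \<open>1 - l n\<close> of the residual, and nonexpansiveness adds back at most the share
  \<open>l n\<close>.\<close>

lemma KM_residual_antimono: "antimono r"
proof (rule decseq_SucI)
  fix n
  have "r (Suc n) \<le> \<rho> (S (x n)) (x (Suc n)) + \<rho> (S (x n)) (S (x (Suc n)))"
    using triangle[of "x (Suc n)" "S (x n)" "S (x (Suc n))"] KM_in(1,2)[of n]
      KM_in(1,2)[of "Suc n"] commute by metis
  also have "\<rho> (S (x n)) (x (Suc n)) \<le> (1 - l n) * r n"
    using W1[of "x n" "S (x n)" "S (x n)" "l n"] KM_in[of n] commute[of "S (x n)" "x n"] by simp
  also note KM_step_image[of n]
  finally show "r (Suc n) \<le> r n" by (simp add: algebra_simps)
qed

lemma KM_images_dist: "\<rho> (S (x i)) (S (x (i + n))) \<le> (\<Sum>s=i..<i+n. l s) * r i"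
proof (induction n)
  case 0
  then show ?case using KM_in by simp
next
  case (Suc n)
  have "\<rho> (S (x i)) (S (x (i + Suc n))) \<le> \<rho> (S (x i)) (S (x (i + n))) + l (i + n) * r (i + n)"
    using triangle[of "S (x i)" "S (x (i + n))" "S (x (Suc (i + n)))"]
      KM_in(2) KM_step_image[of "i + n"] by fastforce
  also have "\<dots> \<le> (\<Sum>s=i..<i+n. l s) * r i + l (i + n) * r i"
    using Suc KM_in(4)[of "i + n"] antimonoD[OF KM_residual_antimono, of i "i + n"]
    by (intro add_mono mult_left_mono) auto
  finally show ?case by (simp add: algebra_simps)
qed

text \<open>Goebel-Kirk inequality. The usual factor \<open>\<Prod> (1 - \<lambda>\<^sub>s)\<^sup>-\<^sup>1\<close> is replaced by the larger
  \<open>exp (\<kappa> \<Sum> \<lambda>\<^sub>s)\<close>, which depends on the sum of the \<open>\<lambda>\<^sub>s\<close> only.\<close>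

lemma goebel_kirk:
  assumes \<kappa>: "\<And>n. 1 \<le> \<kappa> * (1 - l n)"
  shows "(1 + (\<Sum>s=i..<i+n. l s)) * r i
    \<le> \<rho> (x i) (S (x (i + n))) + exp (\<kappa> * (\<Sum>s=i..<i+n. l s)) * (r i - r (i + n))"
\<comment> \<open>The first index is split off: the induction hypothesis is used at
  \<open>Suc i\<close>, with the same end index.\<close>
proof (induction n arbitrary: i)
  case 0
  then show ?case by simp
next
  case (Suc n)
  define s s' where "s = (\<Sum>j=i..<i+Suc n. l j)" and "s' = (\<Sum>j=Suc i..<Suc i+n. l j)"
  define E E' where "E = exp (\<kappa> * s)" and "E' = exp (\<kappa> * s')"
  let ?e = "Suc i + n" and ?l = "l i"
  have s: "s = ?l + s'"
    unfolding s_def s'_def by (simp add: sum.atLeast_Suc_lessThan)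
  have li: "0 \<le> ?l" "?l < 1" using l[of i] by auto
  have "0 < \<kappa>"
  proof (rule ccontr)
    assume "\<not> 0 < \<kappa>"
    then have "\<kappa> * (1 - ?l) \<le> 0" using li by (intro mult_nonpos_nonneg) auto
    then show False using \<kappa>[of i] by linarith
  qed
  then have "\<kappa> * (1 - ?l) \<le> \<kappa> * 1" using li by (intro mult_left_mono) auto
  then have "1 \<le> \<kappa>" using \<kappa>[of i] by linarith
  have "s' \<ge> 0" unfolding s'_def using KM_in(4) by (intro sum_nonneg) auto
  \<comment> \<open>Needed in step 2, where \<open>r (Suc i)\<close> is exchanged for the larger
    \<open>r i\<close>.\<close>
  have "1 + s' \<le> 1 + \<kappa> * s'"
    using \<open>1 \<le> \<kappa>\<close> \<open>s' \<ge> 0\<close> by (simp add: mult_le_cancel_right1)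
  also have "\<dots> \<le> E'" unfolding E'_def by (rule exp_ge_add_one_self)
  finally have E': "1 + s' \<le> E'" .
  \<comment> \<open>Multiplying \<open>1 \<le> \<kappa> * (1 - l i)\<close> by \<open>l i\<close>
    shows that one factor of the exponential compensates for the later division by
    \<open>1 - l i\<close>.\<close>
  have "1 \<le> (1 - ?l) * (1 + \<kappa> * ?l)"
    using mult_left_mono[OF \<kappa>[of i] li(1)] by (simp add: algebra_simps)
  also have "\<dots> \<le> (1 - ?l) * exp (\<kappa> * ?l)"
    using li by (intro mult_left_mono exp_ge_add_one_self) auto
  finally have "1 * E' \<le> ((1 - ?l) * exp (\<kappa> * ?l)) * E'"
    unfolding E'_def by (intro mult_right_mono) auto
  then have E: "E' \<le> (1 - ?l) * E"
    unfolding E_def E'_def s by (simp add: distrib_left exp_add)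
  have r: "r (Suc i) \<le> r i" "r ?e \<le> r i"
    using antimonoD[OF KM_residual_antimono] by (auto simp del: KM_iteration.simps)
  have IH: "(1 + s') * r (Suc i) \<le> \<rho> (x (Suc i)) (S (x ?e)) + E' * (r (Suc i) - r ?e)"
    using Suc[of "Suc i"] unfolding s'_def E'_def .
  have "\<rho> (x (Suc i)) (S (x ?e)) \<le> (1 - ?l) * \<rho> (x i) (S (x ?e)) + ?l * \<rho> (S (x i)) (S (x ?e))"
    using W1[of "x i" "S (x i)" "S (x ?e)" ?l] KM_in[of i] KM_in(2)[of ?e] commute by simp
  also have "\<rho> (S (x i)) (S (x ?e)) \<le> s * r i"
    using KM_images_dist[of i "Suc n"] unfolding s_def by simp
  finally have 1: "\<rho> (x (Suc i)) (S (x ?e)) \<le> (1 - ?l) * \<rho> (x i) (S (x ?e)) + ?l * (s * r i)"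
    using li by (simp add: mult_left_mono)
  have 2: "(1 + s') * (r i - r (Suc i)) \<le> E' * (r i - r (Suc i))"
    using E' r by (intro mult_right_mono) auto
  have 3: "E' * (r i - r ?e) \<le> (1 - ?l) * E * (r i - r ?e)"
    using E r by (intro mult_right_mono) auto
  have "(1 - ?l) * ((1 + s) * r i) = (1 + s') * r i - ?l * (s * r i)"
    unfolding s by (simp add: algebra_simps)
  also have "\<dots> \<le> (1 - ?l) * (\<rho> (x i) (S (x ?e)) + E * (r i - r ?e))"
    using IH 1 2 3 by (simp only: algebra_simps)
  finally have "(1 + s) * r i \<le> \<rho> (x i) (S (x ?e)) + E * (r i - r ?e)"
    using li by (simp add: mult_le_cancel_left)
  then show ?case unfolding s_def E_def by simp
qed

text \<open>The triangle inequality through \<open>x (i + n)\<close> costs \<open>B + r i\<close>,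
  and this \<open>r i\<close> cancels the summand 1 on the left of
  \<open>goebel_kirk\<close>.\<close>

lemma goebel_kirk_bounded:
  assumes "\<And>n. 1 \<le> \<kappa> * (1 - l n)" and B: "\<And>m p. \<rho> (x m) (x p) \<le> B"
  shows "(\<Sum>s=i..<i+n. l s) * r i \<le> B + exp (\<kappa> * (\<Sum>s=i..<i+n. l s)) * (r i - r (i + n))"
proof -
  have "\<rho> (x i) (S (x (i + n))) \<le> B + r i"
    using triangle[of "x i" "x (i + n)" "S (x (i + n))"] KM_in(1,2)[of i] KM_in(1,2)[of "i + n"]
      B[of i "i + n"] antimonoD[OF KM_residual_antimono, of i "i + n"] by simp
  then show ?thesis using goebel_kirk[OF assms(1), of i n] by (simp add: algebra_simps)
qed

end

end

section \<open>A numerical rate from the Goebel-Kirk inequality\<close>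

text \<open>The index \<open>N\<close> is chosen before \<open>r\<close>: this is the uniformity in \<open>u\<close>. The indices are cut into
  blocks on which the \<open>\<lambda>\<^sub>s\<close> sum up to a value in \<open>[P, P + 1]\<close>; while \<open>r \<ge> \<epsilon>\<close>, each block decreases
  \<open>r\<close> by a fixed amount.\<close>

lemma uniform_rate:
  fixes l :: "nat \<Rightarrow> real" and B \<kappa> \<epsilon> :: real
  assumes l: "\<And>n. l n \<in> {0..<1}"
    and div: "\<And>c. \<exists>n. c \<le> (\<Sum>i<n. l i)"
    and "\<epsilon> > 0" "0 \<le> \<kappa>" "0 \<le> B"
  shows "\<exists>N. \<forall>r. antimono r \<longrightarrow> (\<forall>n. 0 \<le> r n) \<longrightarrow> (\<forall>n. l n * r n \<le> B) \<longrightarrow>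
    (\<forall>i n. (\<Sum>s=i..<i+n. l s) * r i \<le> B + exp (\<kappa> * (\<Sum>s=i..<i+n. l s)) * (r i - r (i + n)))
    \<longrightarrow> r N < \<epsilon>"
proof -
  \<comment> \<open>Chosen so that \<open>P * \<epsilon> = B + 1\<close>, which exceeds the additive
    \<open>B\<close> by 1.\<close>
  define P where "P = (B + 1) / \<epsilon>"
  have "P \<ge> 0" using assms by (simp add: P_def)
  have "\<exists>n. P \<le> (\<Sum>s=i..<i+n. l s) \<and> (\<Sum>s=i..<i+n. l s) \<le> P + 1" for i
  proof -
    obtain m where m: "P + (\<Sum>s<i. l s) \<le> (\<Sum>s<m. l s)" using div by blast
    also have "\<dots> \<le> (\<Sum>s<i+m. l s)" using l by (intro sum_mono2) auto
    also have "\<dots> = (\<Sum>s<i. l s) + (\<Sum>s=i..<i+m. l s)"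
      by (metis lessThan_atLeast0 le_add1 sum.atLeastLessThan_concat zero_le)
    finally have ex: "P \<le> (\<Sum>s=i..<i+m. l s)" by simp
    \<comment> \<open>By minimality the sum without its last term is below \<open>P\<close>, and
      that term is below 1.\<close>
    define n where "n = (LEAST n. P \<le> (\<Sum>s=i..<i+n. l s))"
    have n: "P \<le> (\<Sum>s=i..<i+n. l s)" unfolding n_def using ex by (rule LeastI)
    moreover have "(\<Sum>s=i..<i+n. l s) \<le> P + 1"
    proof (cases n)
      case 0
      then show ?thesis using \<open>P \<ge> 0\<close> by simp
    next
      case (Suc k)
      have "\<not> P \<le> (\<Sum>s=i..<i+k. l s)"
        using not_less_Least[of k "\<lambda>n. P \<le> (\<Sum>s=i..<i+n. l s)"] Suc unfolding n_def by simp
      then show ?thesis using Suc l[of "i + k"] by simp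
    qed
    ultimately show ?thesis by blast
  qed
  then obtain g where g: "\<And>i. P \<le> (\<Sum>s=i..<i+g i. l s)" "\<And>i. (\<Sum>s=i..<i+g i. l s) \<le> P + 1"
    by metis
  \<comment> \<open>The blocks start at an index with positive weight: there
    \<open>l j * r j \<le> B\<close> bounds \<open>r j\<close> independently of
    \<open>r\<close>.\<close>
  obtain j where j: "l j > 0"
  proof -
    obtain n where "1 \<le> (\<Sum>i<n. l i)" using div by blast
    then have "\<not> (\<forall>i\<in>{..<n}. l i \<le> 0)"
      using sum_nonpos[of "{..<n}" l] by fastforce
    then show ?thesis using that by (meson not_le)
  qed
  define E where "E = exp (\<kappa> * (P + 1))"
  have "E > 0" by (simp add: E_def)
  define k where "k = rec_nat j (\<lambda>_ i. i + g i)"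
  have k: "k 0 = j" "k (Suc m) = k m + g (k m)" for m by (simp_all add: k_def)
  \<comment> \<open>After this many drops of \<open>1 / E\<close>, the initial bound
    \<open>B / l j\<close> would become negative.\<close>
  obtain m :: nat where m: "B / l j * E < real m" using reals_Archimedean2 by blast
  show ?thesis
  proof (intro exI allI impI)
    fix r :: "nat \<Rightarrow> real"
    assume r: "antimono r" "\<forall>n. 0 \<le> r n" "\<forall>n. l n * r n \<le> B"
      and gk: "\<forall>i n. (\<Sum>s=i..<i+n. l s) * r i
        \<le> B + exp (\<kappa> * (\<Sum>s=i..<i+n. l s)) * (r i - r (i + n))"
    have "r (k m) < \<epsilon> \<or> r (k m) \<le> B / l j - m / E" for m
    proof (induction m)
      case 0
      then show ?case using r(3) j by (simp add: k field_simps)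
    next
      case (Suc m)
      define i where "i = k m"
      have mono: "r (i + g i) \<le> r i" using r(1) by (rule antimonoD) simp
      show ?case
      proof (cases "r i < \<epsilon>")
        case True
        then show ?thesis using mono by (simp add: k i_def)
      next
        case False
        have "B + 1 = P * \<epsilon>" using \<open>\<epsilon> > 0\<close> by (simp add: P_def)
        also have "\<dots> \<le> (\<Sum>s=i..<i+g i. l s) * r i"
          using g(1)[of i] False \<open>P \<ge> 0\<close> \<open>\<epsilon> > 0\<close> by (intro mult_mono) auto
        also have "\<dots> \<le> B + exp (\<kappa> * (\<Sum>s=i..<i+g i. l s)) * (r i - r (i + g i))"
          using gk by blast
        also have "\<dots> \<le> B + E * (r i - r (i + g i))"
          unfolding E_def using g(2)[of i] mono \<open>0 \<le> \<kappa>\<close>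
          by (intro add_left_mono mult_right_mono) (auto intro!: mult_left_mono)
        finally have "1 / E \<le> r i - r (i + g i)" using \<open>E > 0\<close> by (simp add: field_simps)
        moreover have "r i \<le> B / l j - m / E" using Suc False by (simp add: i_def)
        ultimately show ?thesis by (simp add: k i_def add_divide_distrib)
      qed
    qed
    moreover have "B / l j < m / E" using m \<open>E > 0\<close> by (simp add: field_simps)
    ultimately show "r (k m) < \<epsilon>" using r(2) by (smt (verit))
  qed
qed

section \<open>Approximate fixed points in \<open>H\<close>\<close>

theorem theorem2p10:
  fixes X :: "'a set" and \<rho> :: "'a \<Rightarrow> 'a \<Rightarrow> real"
    and W :: "'a \<Rightarrow> 'a \<Rightarrow> real \<Rightarrow> 'a"
    and M :: "'m set" and d :: "'m \<Rightarrow> 'm \<Rightarrow> real"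
    and C :: "'m \<Rightarrow> 'a set" and \<delta> :: "'m \<Rightarrow> 'a"
    and H :: "('a \<times> 'm) set" and T :: "'a \<times> 'm \<Rightarrow> 'a \<times> 'm"
    and T\<^sub>u :: "'m \<Rightarrow> 'a \<Rightarrow> 'a"
    and l :: "nat \<Rightarrow> real" and K :: nat and \<alpha> :: "nat \<Rightarrow> nat"
  assumes hyperbolic: "hyperbolic_space X \<rho> W"
    and metric_M: "Metric_space M d"
    and AFPP_M: "AFPP M d"
    and C: "\<And>u. u \<in> M \<Longrightarrow> C u \<noteq> {} \<and> C u \<subseteq> X \<and> W_convex W (C u)"
    and delta: "nonexpansive M d (\<Union>u\<in>M. C u) \<rho> \<delta>" "\<And>u. u \<in> M \<Longrightarrow> \<delta> u \<in> C u"
    and H: "H = {(x, u). u \<in> M \<and> x \<in> C u}"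
    and T: "nonexpansive H (dist_max \<rho> d) H (dist_max \<rho> d) T"
    and fst_T: "\<And>x u. (x, u) \<in> H \<Longrightarrow> (fst \<circ> T) (x, u) \<in> C u"
    and T\<^sub>u: "\<And>u x. u \<in> M \<Longrightarrow> x \<in> C u \<Longrightarrow> T\<^sub>u u x = (fst \<circ> T) (x, u)"
    and l: "\<And>n. l n \<in> {0..<1}"
    and K_pos: "K > 0"
    and l_K: "\<And>n. l n \<le> 1 - 1 / real K"
    and alpha: "\<And>n. real n \<le> (\<Sum>i=0..\<alpha> n. l i)"
    and bounded_orbits: "\<exists>b>0. \<forall>u\<in>M. \<exists>y\<in>C u. \<rho> (\<delta> u) y \<le> b \<and>
      (\<forall>m p. \<rho> (KM_iteration W l (T\<^sub>u u) y m) (KM_iteration W l (T\<^sub>u u) y p) \<le> b)"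
  shows "min_displacement H (dist_max \<rho> d) T = 0"
proof -
  interpret hyperbolic_space X \<rho> W by fact
  interpret M: Metric_space M d by fact
  obtain b where "b > 0" and b: "\<And>u. u \<in> M \<Longrightarrow> \<exists>y\<in>C u. \<rho> (\<delta> u) y \<le> b \<and>
      (\<forall>m p. \<rho> (KM_iteration W l (T\<^sub>u u) y m) (KM_iteration W l (T\<^sub>u u) y p) \<le> b)"
    using bounded_orbits by blast
  have Tu_close: "\<rho> (T\<^sub>u u x) (T\<^sub>u v x') \<le> max (\<rho> x x') (d u v)"
    if "u \<in> M" "v \<in> M" "x \<in> C u" "x' \<in> C v" for u v x x'
    using that T T\<^sub>u unfolding nonexpansive_def dist_max_def H by fastforce
  have Tu_in: "T\<^sub>u u \<in> C u \<rightarrow> C u" if "u \<in> M" for u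
    using that T\<^sub>u fst_T by (auto simp: H)
  have Tu: "nonexpansive (C u) \<rho> (C u) \<rho> (T\<^sub>u u)" if "u \<in> M" for u
    using that Tu_in[OF that] Tu_close[OF that that] by (fastforce simp: nonexpansive_def)
  have CX: "C u \<subseteq> X" "W_convex W (C u)" if "u \<in> M" for u using C that by auto
  define z where "z n u = KM_iteration W l (T\<^sub>u u) (\<delta> u) n" for n u
  have z_in: "z n u \<in> C u" if "u \<in> M" for n u
    unfolding z_def using that CX Tu_in delta(2) l by (intro KM_iteration_in) auto
  \<comment> \<open>With \<open>D = d u v\<close>, the maximum in \<open>Tu_close\<close> collapses
    to \<open>d u v\<close>.\<close>
  have z_close: "\<rho> (z n u) (z n v) \<le> d u v" if uv: "u \<in> M" "v \<in> M" for n u v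
    unfolding z_def
  proof (rule KM_iteration_close[of "C u" _ _ "C v"])
    show "\<rho> (T\<^sub>u u x) (T\<^sub>u v x') \<le> d u v" if "x \<in> C u" "x' \<in> C v" "\<rho> x x' \<le> d u v" for x x'
      using Tu_close[OF uv that(1,2)] that(3) by simp
    show "\<rho> (\<delta> u) (\<delta> v) \<le> d u v" using delta(1) uv by (auto simp: nonexpansive_def)
  qed (use uv CX Tu_in delta(2) l in auto)
  have bounded: "\<rho> (z m u) (z p u) \<le> 3 * b" if u: "u \<in> M" for m p u
  proof -
    obtain y where y: "y \<in> C u" "\<rho> (\<delta> u) y \<le> b"
      and orb: "\<And>m p. \<rho> (KM_iteration W l (T\<^sub>u u) y m) (KM_iteration W l (T\<^sub>u u) y p) \<le> b"
      using b[OF u] by blast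
    let ?y = "KM_iteration W l (T\<^sub>u u) y"
    \<comment> \<open>The comparison lemma for one and the same map, with
      \<open>D = b\<close>.\<close>
    have zy: "\<rho> (z n u) (?y n) \<le> b" for n
      unfolding z_def
    proof (rule KM_iteration_close[of "C u" _ _ "C u"])
      show "\<rho> (T\<^sub>u u x) (T\<^sub>u u x') \<le> b" if "x \<in> C u" "x' \<in> C u" "\<rho> x x' \<le> b" for x x'
        using Tu[OF u] that by (fastforce simp: nonexpansive_def)
    qed (use u CX Tu_in delta(2) l y in auto)
    have yX: "?y n \<in> X" for n
      using KM_iteration_in[of W "C u" "T\<^sub>u u" y l n] CX[OF u] Tu_in[OF u] y l by blast
    have zX: "z n u \<in> X" for n using z_in[OF u] CX[OF u] by blast
    show ?thesis
      using triangle[OF zX[of m] yX[of m] zX[of p]] triangle[OF yX[of m] yX[of p] zX[of p]]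
        zy[of m] zy[of p] orb[of m p] commute[of "?y p" "z p u"] by linarith
  qed
  have regular: "\<exists>N. \<forall>u\<in>M. \<rho> (z N u) (T\<^sub>u u (z N u)) < \<epsilon>" if "\<epsilon> > 0" for \<epsilon>
  proof -
    have div: "\<exists>n. c \<le> (\<Sum>i<n. l i)" for c :: real
    proof -
      obtain n :: nat where "c \<le> n" using real_arch_simple by blast
      then have "c \<le> (\<Sum>i<Suc (\<alpha> n). l i)"
        using alpha[of n] by (simp only: lessThan_Suc_atMost atMost_atLeast0)
      then show ?thesis by blast
    qed
    have K: "1 \<le> real K * (1 - l n)" for n
      using l_K[of n] K_pos by (simp add: field_simps)
    obtain N where N: "\<And>r. antimono r \<Longrightarrow> (\<forall>n. 0 \<le> r n) \<Longrightarrow> (\<forall>n. l n * r n \<le> 3 * b) \<Longrightarrow>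
      (\<forall>i n. (\<Sum>s=i..<i+n. l s) * r i
        \<le> 3 * b + exp (real K * (\<Sum>s=i..<i+n. l s)) * (r i - r (i + n))) \<Longrightarrow> r N < \<epsilon>"
      using uniform_rate[OF l div \<open>\<epsilon> > 0\<close>, of "real K" "3 * b"] \<open>b > 0\<close> by auto
    have "\<rho> (z N u) (T\<^sub>u u (z N u)) < \<epsilon>" if u: "u \<in> M" for u
    proof (rule N[of "\<lambda>n. \<rho> (z n u) (T\<^sub>u u (z n u))"])
      note hyps = CX[OF u] Tu[OF u] l delta(2)[OF u]
      show "antimono (\<lambda>n. \<rho> (z n u) (T\<^sub>u u (z n u)))"
        unfolding z_def by (rule KM_residual_antimono[OF hyps])
      show "\<forall>n. l n * \<rho> (z n u) (T\<^sub>u u (z n u)) \<le> 3 * b"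
      proof
        fix n
        show "l n * \<rho> (z n u) (T\<^sub>u u (z n u)) \<le> 3 * b"
          \<comment> \<open>By \<open>KM_step\<close> the left side is the distance of consecutive
            iterates.\<close>
          using bounded[OF u, of n "Suc n"] unfolding z_def KM_step[OF hyps, where n = n] .
      qed
      show "\<forall>i n. (\<Sum>s=i..<i+n. l s) * \<rho> (z i u) (T\<^sub>u u (z i u))
        \<le> 3 * b + exp (real K * (\<Sum>s=i..<i+n. l s))
          * (\<rho> (z i u) (T\<^sub>u u (z i u)) - \<rho> (z (i + n) u) (T\<^sub>u u (z (i + n) u)))"
        unfolding z_def
        by (intro allI goebel_kirk_bounded[OF hyps K bounded[OF u, unfolded z_def]])
    qed simp
    then show ?thesis by blast
  qed
  have small: "\<exists>p\<in>H. dist_max \<rho> d p (T p) < \<epsilon>" if "\<epsilon> > 0" for \<epsilon>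
  proof -
    obtain N where N: "\<And>u. u \<in> M \<Longrightarrow> \<rho> (z N u) (T\<^sub>u u (z N u)) < \<epsilon>"
      using regular[OF \<open>\<epsilon> > 0\<close>] by blast
    have zH: "(z N u, u) \<in> H" if "u \<in> M" for u using that z_in by (simp add: H)
    have "nonexpansive M d M d (\<lambda>u. snd (T (z N u, u)))"
      unfolding nonexpansive_def
    proof (intro conjI ballI Pi_I)
      fix u assume "u \<in> M"
      then have "T (z N u, u) \<in> H" using T zH by (auto simp: nonexpansive_def)
      then show "snd (T (z N u, u)) \<in> M" by (auto simp: H)
    next
      fix u v assume uv: "u \<in> M" "v \<in> M"
      then have "dist_max \<rho> d (T (z N u, u)) (T (z N v, v)) \<le> dist_max \<rho> d (z N u, u) (z N v, v)"
        using T zH by (auto simp: nonexpansive_def)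
      then show "d (snd (T (z N u, u))) (snd (T (z N v, v))) \<le> d u v"
        using z_close[OF uv] by (simp add: dist_max_def)
    qed
    then obtain w where w: "\<And>n::nat. w n \<in> M" "(\<lambda>n. d (w n) (snd (T (z N (w n), w n)))) \<longlonglongrightarrow> 0"
      using AFPP_M unfolding AFPP_def by blast
    have "eventually (\<lambda>n. d (w n) (snd (T (z N (w n), w n))) < \<epsilon>) sequentially"
      using w(2) that by (rule order_tendstoD)
    then obtain n where n: "d (w n) (snd (T (z N (w n), w n))) < \<epsilon>"
      by (auto simp: eventually_sequentially)
    \<comment> \<open>The first component is small by regularity, the second by the choice of
      \<open>w n\<close>.\<close>
    then have "dist_max \<rho> d (z N (w n), w n) (T (z N (w n), w n)) < \<epsilon>"
      using N[OF w(1)] T\<^sub>u[OF w(1) z_in[OF w(1)]] by (simp add: dist_max_def)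
    then show ?thesis using zH[OF w(1)] by blast
  qed
  have nonneg: "0 \<le> dist_max \<rho> d p q" for p q
    by (simp add: dist_max_def le_max_iff_disj)
  then have bdd: "bdd_below ((\<lambda>p. dist_max \<rho> d p (T p)) ` H)"
    by (intro bdd_belowI[of _ 0]) blast
  have "H \<noteq> {}" using small[of 1] by auto
  show ?thesis unfolding min_displacement_def
  proof (rule antisym)
    show "(INF p\<in>H. dist_max \<rho> d p (T p)) \<le> 0"
    proof (rule field_le_epsilon)
      fix \<epsilon> :: real assume "\<epsilon> > 0"
      then show "(INF p\<in>H. dist_max \<rho> d p (T p)) \<le> 0 + \<epsilon>"
        using small[of \<epsilon>] cINF_lower2[OF bdd] by fastforce
    qed
    show "0 \<le> (INF p\<in>H. dist_max \<rho> d p (T p))"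
      using \<open>H \<noteq> {}\<close> nonneg by (intro cINF_greatest)
  qed
qed

end
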